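(* Let $n\ge 2$ and let $H_1,\ldots,H_n$ be pairwise incompatible events (i.e. $H_iH_j=\emptyset$ for $i\ne j$) such that the conditioning events $\overline{H}_1,\ \overline{H}_1\overline{H}_2,\ldots,\overline{H}_1\cdots\overline{H}_{n-1}$ are all $\neq\emptyset$, with all previsions involved coherently assessed (conditioning events are allowed to have probability zero). Then \[ (H_1|\Omega)\wedge(H_2|\overline{H}_1)\wedge\cdots\wedge(H_n|\overline{H}_1\cdots\overline{H}_{n-1})=P(H_2|\overline{H}_1)\cdots P(H_n|\overline{H}_1\cdots\overline{H}_{n-1})\,H_1, \] so that \[ \mathbb{P}\big[(H_1|\Omega)\wedge(H_2|\overline{H}_1)\wedge\cdots\wedge(H_n|\overline{H}_1\cdots\overline{H}_{n-1})\big]=P(H_1)\,P(H_2|\overline{H}_1)\cdots P(H_n|\overline{H}_1\cdots\overline{H}_{n-1}). \]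
   Context: Events. Events are elements of a Boolean algebra with top $\Omega$ (sure event) and bottom $\emptyset$ (impossible event); one may take subsets of a set $\Omega$. An event is identified with its $0/1$ indicator; $EF$ or $E\wedge F$ is conjunction, $E\vee F$ disjunction, $\overline{E}$ negation. Conditional random quantities. Given an event $H\neq\emptyset$, a random quantity $X$ (a real-valued function on $\Omega$ with finitely many values on $H$) and an assessed real number $\mu=\mathbb{P}(X|H)$ (the conditional prevision), the conditional random quantity $X|H$ is $XH+\mu\overline{H}$ (value $X$ if $H$ is true, $\mu$ if $H$ is false). For a conditional event $E|H$ with $P(E|H)=x$, its indicator (same symbol) is $E|H=EH+x\overline{H}$; it is true, false or void when $EH$, $\overline{E}H$ or $\overline{H}$ is true, respectively. In particular $E|\Omega=E$ and $P(E)=P(E|\Omega)$. Coherence. A prevision assessment on a family of conditional random quantities is coherent if for every finite subfamily $X_1|K_1,\ldots,X_m|K_m$ with assessed previsions $\mu_1,\ldots,\mu_m$ and all real $s_1,\ldots,s_m$, the random gain $G=\sum_{i=1}^m s_iK_i(X_i-\mu_i)$, restricted to $K_1\vee\cdots\vee K_m$, satisfies $\min G\le 0\le\max G$. Conjunction. For a finite family $(A_i|K_i)_{i\in T}$ of conditional events, the conjunctions $\mathscr{C}_S=\bigwedge_{i\in S}(A_i|K_i)$, $\emptyset\ne S\subseteq T$, with assessed previsions $x_S=\mathbb{P}(\mathscr{C}_S)$, are defined recursively on $|S|$ by \[ \mathscr{C}_S=\Big[\bigwedge_{i\in S}A_iK_i+\sum_{\emptyset\neq R\subsetneq S}x_R\Big(\bigwedge_{i\in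 R}\overline{K}_i\Big)\wedge\Big(\bigwedge_{i\in S\setminus R}A_iK_i\Big)\Big]\Big|\Big(\bigvee_{i\in S}K_i\Big), \] i.e. $\mathscr{C}_S$ has value $1$ if all $A_iK_i$ ($i\in S$) are true; $0$ if some $\overline{A}_iK_i$ is true; $x_R$ if exactly the conditional events with index in $R$ are void and the others are true ($\emptyset\ne R\subsetneq S$); $x_S$ if all $K_i$, $i\in S$, are false. For $S=\{i\}$, $\mathscr{C}_S=A_i|K_i$. Standing assumption. The previsions assessed for all the conditional events $H_1|\Omega,\ H_j|\overline{H}_1\cdots\overline{H}_{j-1}$ ($2\le j\le n$) and all conjunctions of sub-families of them form a coherent assessment. Equality of conditional random quantities means equality of values in all cases (as functions on $\Omega$). *)

theory Defs
  imports Complex_Main "HOL-Library.Indicator_Function" "HOL-Library.Disjoint_Sets"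
begin

text \<open>Events are subsets of the sure event \<^term>\<open>UNIV :: 'w set\<close>; random quantities are functions
  \<^typ>\<open>'w \<Rightarrow> real\<close>. Assessed previsions are given numbers, not integrals against a measure.\<close>

definition cond_rq :: "('w \<Rightarrow> real) \<Rightarrow> 'w set \<Rightarrow> real \<Rightarrow> 'w \<Rightarrow> real" where
  "cond_rq X H \<mu> = (\<lambda>\<omega>. X \<omega> * indicator H \<omega> + \<mu> * indicator (- H) \<omega>)"

definition cond_event :: "'w set \<Rightarrow> 'w set \<Rightarrow> real \<Rightarrow> 'w \<Rightarrow> real" where
  "cond_event E H x = cond_rq (indicator E) H x"

definition gain ::
  "('i \<Rightarrow> 'w \<Rightarrow> real) \<Rightarrow> ('i \<Rightarrow> 'w set) \<Rightarrow> ('i \<Rightarrow> real) \<Rightarrow> 'i set \<Rightarrow> ('i \<Rightarrow> real) \<Rightarrow> 'w \<Rightarrow> real" where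
  "gain X K \<mu> J s = (\<lambda>\<omega>. \<Sum>i\<in>J. s i * indicator (K i) \<omega> * (X i \<omega> - \<mu> i))"

text \<open>The first conjunct is the well-formedness of each \<open>X i | K i\<close>. It makes the sets below finite
  and nonempty, so that \<^const>\<open>Min\<close> and \<^const>\<open>Max\<close> are the true minimum and maximum.\<close>

definition coherent ::
  "'i set \<Rightarrow> ('i \<Rightarrow> 'w \<Rightarrow> real) \<Rightarrow> ('i \<Rightarrow> 'w set) \<Rightarrow> ('i \<Rightarrow> real) \<Rightarrow> bool" where
  "coherent I X K \<mu> \<longleftrightarrow>
     (\<forall>i\<in>I. K i \<noteq> {} \<and> finite (X i ` K i)) \<and>
     (\<forall>J s. J \<subseteq> I \<and> finite J \<and> J \<noteq> {} \<longrightarrow>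
        Min (gain X K \<mu> J s ` (\<Union>i\<in>J. K i)) \<le> 0 \<and>
        0 \<le> Max (gain X K \<mu> J s ` (\<Union>i\<in>J. K i)))"

text \<open>Conjunction of the conditional events \<open>A i | K i\<close> with \<open>i \<in> S\<close>. The number \<open>x R\<close> is the
  assessed prevision of the conjunction over \<open>R\<close>; in particular \<open>x {i}\<close> is \<open>P(A i | K i)\<close>. Since
  all these numbers are supplied by the assessment \<open>x\<close>, no recursion on \<open>S\<close> is needed.\<close>

definition conj_payoff ::
  "('i \<Rightarrow> 'w set) \<Rightarrow> ('i \<Rightarrow> 'w set) \<Rightarrow> ('i set \<Rightarrow> real) \<Rightarrow> 'i set \<Rightarrow> 'w \<Rightarrow> real" where
  "conj_payoff A K x S = (\<lambda>\<omega>. indicator (\<Inter>i\<in>S. A i \<inter> K i) \<omega> +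
     (\<Sum>R | R \<noteq> {} \<and> R \<subset> S.
        x R * indicator ((\<Inter>i\<in>R. - K i) \<inter> (\<Inter>i\<in>S - R. A i \<inter> K i)) \<omega>))"

definition conj_cond :: "('i \<Rightarrow> 'w set) \<Rightarrow> 'i set \<Rightarrow> 'w set" where
  "conj_cond K S = (\<Union>i\<in>S. K i)"

definition conjunction ::
  "('i \<Rightarrow> 'w set) \<Rightarrow> ('i \<Rightarrow> 'w set) \<Rightarrow> ('i set \<Rightarrow> real) \<Rightarrow> 'i set \<Rightarrow> 'w \<Rightarrow> real" where
  "conjunction A K x S = cond_rq (conj_payoff A K x S) (conj_cond K S) (x S)"

definition coherent_conjunctions ::
  "'i set \<Rightarrow> ('i \<Rightarrow> 'w set) \<Rightarrow> ('i \<Rightarrow> 'w set) \<Rightarrow> ('i set \<Rightarrow> real) \<Rightarrow> bool" where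
  "coherent_conjunctions T A K x \<longleftrightarrow>
     coherent {S. S \<noteq> {} \<and> S \<subseteq> T} (conj_payoff A K x) (conj_cond K) x"

text \<open>For \<open>j = 1\<close> this is the sure event.\<close>

definition none_before :: "(nat \<Rightarrow> 'w set) \<Rightarrow> nat \<Rightarrow> 'w set" where
  "none_before H j = (\<Inter>i\<in>{1..<j}. - H i)"

lemma cond_rq_simps:
  "\<omega> \<in> H \<Longrightarrow> cond_rq X H \<mu> \<omega> = X \<omega>"
  "\<omega> \<notin> H \<Longrightarrow> cond_rq X H \<mu> \<omega> = \<mu>"
  by (simp_all add: cond_rq_def)

lemma conjunction_singleton: "conjunction A K x {i} = cond_event (A i) (K i) (x {i})"
proof -
  have *: "{R. R \<noteq> {} \<and> R \<subset> {i}} = {}" by blast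
  have "conj_payoff A K x {i} = indicator (A i \<inter> K i)"
    unfolding conj_payoff_def * by simp
  then show ?thesis
    unfolding conjunction_def cond_event_def cond_rq_def conj_cond_def
    by (simp add: fun_eq_iff indicator_def)
qed

lemma conjunction_all_true:
  assumes "S \<noteq> {}" "\<And>i. i \<in> S \<Longrightarrow> \<omega> \<in> A i \<inter> K i"
  shows "conjunction A K x S \<omega> = 1"
proof -
  have "(\<Sum>R | R \<noteq> {} \<and> R \<subset> S.
     x R * indicator ((\<Inter>i\<in>R. - K i) \<inter> (\<Inter>i\<in>S - R. A i \<inter> K i)) \<omega>) = 0"
  proof (intro sum.neutral ballI)
    fix R assume "R \<in> {R. R \<noteq> {} \<and> R \<subset> S}"
    then have "\<omega> \<notin> (\<Inter>i\<in>R. - K i) \<inter> (\<Inter>i\<in>S - R. A i \<inter> K i)"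
      using assms by blast
    then show "x R * indicator ((\<Inter>i\<in>R. - K i) \<inter> (\<Inter>i\<in>S - R. A i \<inter> K i)) \<omega> = 0"
      by (simp only: indicator_simps mult_zero_right not_False_eq_True)
  qed
  moreover have "\<omega> \<in> (\<Inter>i\<in>S. A i \<inter> K i)" "\<omega> \<in> conj_cond K S"
    using assms unfolding conj_cond_def by blast+
  ultimately show ?thesis
    unfolding conjunction_def conj_payoff_def by (simp only: cond_rq_simps indicator_simps add_0_right)
qed

lemma conjunction_some_false:
  assumes "i \<in> S" "\<omega> \<in> K i - A i"
  shows "conjunction A K x S \<omega> = 0"
proof -
  have "(\<Sum>R | R \<noteq> {} \<and> R \<subset> S.
     x R * indicator ((\<Inter>i\<in>R. - K i) \<inter> (\<Inter>i\<in>S - R. A i \<inter> K i)) \<omega>) = 0"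
  proof (intro sum.neutral ballI)
    fix R
    have "\<omega> \<notin> (\<Inter>i\<in>R. - K i) \<inter> (\<Inter>i\<in>S - R. A i \<inter> K i)"
      using assms by blast
    then show "x R * indicator ((\<Inter>i\<in>R. - K i) \<inter> (\<Inter>i\<in>S - R. A i \<inter> K i)) \<omega> = 0"
      by (simp only: indicator_simps mult_zero_right not_False_eq_True)
  qed
  moreover have "\<omega> \<notin> (\<Inter>i\<in>S. A i \<inter> K i)" "\<omega> \<in> conj_cond K S"
    using assms unfolding conj_cond_def by blast+
  ultimately show ?thesis
    unfolding conjunction_def conj_payoff_def
    by (simp only: cond_rq_simps indicator_simps add_0_right not_False_eq_True)
qed

lemma conjunction_some_void:
  assumes "finite S" "R \<noteq> {}" "R \<subset> S"
    and "\<And>i. i \<in> R \<Longrightarrow> \<omega> \<notin> K i" "\<And>i. i \<in> S - R \<Longrightarrow> \<omega> \<in> A i \<inter> K i"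
  shows "conjunction A K x S \<omega> = x R"
proof -
  let ?C = "\<lambda>Q. (\<Inter>i\<in>Q. - K i) \<inter> (\<Inter>i\<in>S - Q. A i \<inter> K i)"
  have fin: "finite {R. R \<noteq> {} \<and> R \<subset> S}"
    using assms(1) by (rule finite_subset[rotated, OF finite_Pow_iff[THEN iffD2]]) blast
  have iff: "\<omega> \<in> ?C Q \<longleftrightarrow> Q = R" if "Q \<subset> S" for Q
  proof
    assume a: "\<omega> \<in> ?C Q"
    have "i \<in> Q \<longleftrightarrow> i \<in> R" for i
      using a assms(3-5) that by (cases "i \<in> S") blast+
    then show "Q = R" by blast
  next
    assume "Q = R"
    then show "\<omega> \<in> ?C Q" using assms(4,5) by blast
  qed
  have "x Q * indicator (?C Q) \<omega> = (if Q = R then x R else 0)" if "Q \<subset> S" for Q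
    unfolding indicator_def iff[OF that] by simp
  then have "(\<Sum>Q | Q \<noteq> {} \<and> Q \<subset> S. x Q * indicator (?C Q) \<omega>)
     = (\<Sum>Q | Q \<noteq> {} \<and> Q \<subset> S. if Q = R then x R else 0)"
    by (intro sum.cong) blast+
  also have "\<dots> = x R"
    using assms(2,3) fin by (subst sum.delta) (auto)
  finally have "(\<Sum>Q | Q \<noteq> {} \<and> Q \<subset> S. x Q * indicator (?C Q) \<omega>) = x R" .
  moreover have "\<omega> \<notin> (\<Inter>i\<in>S. A i \<inter> K i)" "\<omega> \<in> conj_cond K S"
    using assms(2-5) unfolding conj_cond_def by blast+
  ultimately show ?thesis
    unfolding conjunction_def conj_payoff_def
    by (simp only: cond_rq_simps indicator_simps add_0_left not_False_eq_True)
qed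

lemma conjunction_all_void:
  assumes "\<And>i. i \<in> S \<Longrightarrow> \<omega> \<notin> K i"
  shows "conjunction A K x S \<omega> = x S"
proof -
  have "\<omega> \<notin> conj_cond K S"
    using assms unfolding conj_cond_def by blast
  then show ?thesis
    unfolding conjunction_def by (rule cond_rq_simps)
qed

end

theory Submission imports Defs begin

text \<open>
  The events conditioned on form a decreasing chain, and \<open>H m\<close> is incompatible with every
  conditioning event after the \<open>m\<close>-th. Hence, in the conjunction of the conditional events with
  indices \<open>m, \<dots>, n\<close>, the first one decides everything as long as it is not void: if it is false,
  the conjunction is \<open>0\<close>; if it is true, all later ones are void together, and the conjunction
  takes the value \<open>P {Suc m..n}\<close> (lemma \<open>conjunction_tail\<close>). So the conjunction and the single
  conditional event \<open>H m | none_before H m\<close> have the same conditioning event, and there the first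
  is a constant multiple of the second. Coherence forces previsions to be homogeneous
  (lemma \<open>coherent_scale\<close>), which gives \<open>P {m..n} = P {m} * P {Suc m..n}\<close>. Iterating from \<open>m = n\<close>
  downwards yields the product formula. No division by a prevision occurs, so conditioning events
  of probability zero cause no trouble.
\<close>

text \<open>
  Betting one unit on \<open>X j\<close> and \<open>- c\<close> units on \<open>X i\<close> gives the same gain \<open>c * \<mu> i - \<mu> j\<close> in all
  cases where the bet is not called off. Coherence excludes a sure nonzero gain.
\<close>

lemma coherent_scale:
  assumes coh: "coherent I X K \<mu>"
    and ij: "i \<in> I" "j \<in> I" "i \<noteq> j"
    and same: "K j = K i"
    and scale: "\<And>\<omega>. \<omega> \<in> K i \<Longrightarrow> X j \<omega> = c * X i \<omega>"
  shows "\<mu> j = c * \<mu> i"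
proof -
  define s :: "_ \<Rightarrow> real" where "s = (\<lambda>k. if k = j then 1 else - c)"
  let ?G = "gain X K \<mu> {i, j} s ` (\<Union>k\<in>{i, j}. K k)"
  have "K i \<noteq> {}" using coh ij(1) unfolding coherent_def by blast
  moreover have "gain X K \<mu> {i, j} s \<omega> = c * \<mu> i - \<mu> j" if "\<omega> \<in> K i" for \<omega>
    using that ij(3) same scale[OF that] by (simp add: gain_def s_def algebra_simps)
  ultimately have "?G = {c * \<mu> i - \<mu> j}" using same by auto
  moreover have "Min ?G \<le> 0 \<and> 0 \<le> Max ?G"
  proof -
    have "\<forall>J s. J \<subseteq> I \<and> finite J \<and> J \<noteq> {} \<longrightarrow>
        Min (gain X K \<mu> J s ` (\<Union>k\<in>J. K k)) \<le> 0 \<and>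
        0 \<le> Max (gain X K \<mu> J s ` (\<Union>k\<in>J. K k))"
      using coh unfolding coherent_def by (rule conjunct2)
    from this[rule_format, of "{i, j}" s] show ?thesis using ij(1,2) by simp
  qed
  ultimately show ?thesis by simp
qed

lemma none_before_antimono: "i \<le> j \<Longrightarrow> none_before H j \<subseteq> none_before H i"
  unfolding none_before_def by auto

lemma none_before_disjoint: "1 \<le> i \<Longrightarrow> i < j \<Longrightarrow> H i \<inter> none_before H j = {}"
  unfolding none_before_def by auto

lemma conj_cond_tail:
  assumes "m \<le> n"
  shows "conj_cond (none_before H) {m..n} = none_before H m"
proof
  show "conj_cond (none_before H) {m..n} \<subseteq> none_before H m"
    unfolding conj_cond_def by (rule UN_least, rule none_before_antimono) simp
  show "none_before H m \<subseteq> conj_cond (none_before H) {m..n}"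
    unfolding conj_cond_def by (rule UN_upper) (use assms in simp)
qed

lemma conj_payoff_eq_conjunction:
  "\<omega> \<in> conj_cond K S \<Longrightarrow> conj_payoff A K x S \<omega> = conjunction A K x S \<omega>"
  by (simp add: conjunction_def cond_rq_simps)

lemma conjunction_tail:
  assumes m: "1 \<le> m" "m < n" and \<omega>: "\<omega> \<in> none_before H m"
  shows "conjunction H (none_before H) x {m..n} \<omega> = x {Suc m..n} * indicator (H m) \<omega>"
proof (cases "\<omega> \<in> H m")
  case True
  have "conjunction H (none_before H) x {m..n} \<omega> = x {Suc m..n}"
  proof (rule conjunction_some_void)
    show "{Suc m..n} \<noteq> {}" "{Suc m..n} \<subset> {m..n}" using m by auto
    show "\<omega> \<notin> none_before H i" if "i \<in> {Suc m..n}" for i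
      using that True none_before_disjoint[of m i H] m by auto
    show "\<omega> \<in> H i \<inter> none_before H i" if "i \<in> {m..n} - {Suc m..n}" for i
    proof -
      have "i = m" using that by auto
      then show ?thesis using True \<omega> by simp
    qed
  qed simp
  then show ?thesis using True by simp
next
  case False
  then show ?thesis
    using conjunction_some_false[of m "{m..n}" \<omega> "none_before H" H x] m \<omega> by simp
qed

lemma prevision_tail_step:
  assumes coh: "coherent_conjunctions {1..n} H (none_before H) P"
    and m: "1 \<le> m" "m < n"
  shows "P {m..n} = P {m} * P {Suc m..n}"
proof -
  have cond: "conj_cond (none_before H) {m..n} = none_before H m"
      "conj_cond (none_before H) {m} = none_before H m"
    using conj_cond_tail[of m n H] conj_cond_tail[of m m H] m by auto
  have "P {m..n} = P {Suc m..n} * P {m}"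
  proof (rule coherent_scale[OF coh[unfolded coherent_conjunctions_def]])
    show "{m} \<in> {S. S \<noteq> {} \<and> S \<subseteq> {1..n}}" "{m..n} \<in> {S. S \<noteq> {} \<and> S \<subseteq> {1..n}}"
      using m by auto
    have "n \<in> {m..n}" "n \<notin> {m}" using m by auto
    then show "{m} \<noteq> {m..n}" by blast
    show "conj_cond (none_before H) {m..n} = conj_cond (none_before H) {m}"
      using cond by simp
  next
    fix \<omega> assume "\<omega> \<in> conj_cond (none_before H) {m}"
    then have \<omega>: "\<omega> \<in> none_before H m" using cond by simp
    then have "conj_payoff H (none_before H) P {m} \<omega> = indicator (H m) \<omega>"
      using cond by (simp add: conj_payoff_eq_conjunction conjunction_singleton
          cond_event_def cond_rq_simps)
    moreover have "conj_payoff H (none_before H) P {m..n} \<omega> = P {Suc m..n} * indicator (H m) \<omega>"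
      using \<omega> cond m by (simp add: conj_payoff_eq_conjunction conjunction_tail)
    ultimately show "conj_payoff H (none_before H) P {m..n} \<omega>
        = P {Suc m..n} * conj_payoff H (none_before H) P {m} \<omega>"
      by simp
  qed
  then show ?thesis by simp
qed

lemma prevision_tail:
  assumes coh: "coherent_conjunctions {1..n} H (none_before H) P"
    and m: "1 \<le> m" "m \<le> n"
  shows "P {m..n} = (\<Prod>j = m..n. P {j})"
  using m(2,1)
proof (induction rule: inc_induct)
  case base
  then show ?case by simp
next
  case (step k)
  have "P {k..n} = P {k} * P {Suc k..n}"
    using prevision_tail_step[OF coh] step by simp
  also have "P {Suc k..n} = (\<Prod>j = Suc k..n. P {j})"
    using step by simp
  also have "P {k} * (\<Prod>j = Suc k..n. P {j}) = (\<Prod>j = k..n. P {j})"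
    using step by (intro prod.atLeast_Suc_atMost[symmetric]) simp
  finally show ?case .
qed

theorem theorem18:
  fixes n :: nat
    and H :: "nat \<Rightarrow> 'w set"
    and P :: "nat set \<Rightarrow> real"
  assumes "n \<ge> 2"
    and "disjoint_family_on H {1..n}"
    and "\<And>j. j \<in> {2..n} \<Longrightarrow> none_before H j \<noteq> {}"
    and "coherent_conjunctions {1..n} H (none_before H) P"
  shows "conjunction H (none_before H) P {1..n} =
           (\<lambda>\<omega>. (\<Prod>j = 2..n. P {j}) * indicator (H 1) \<omega>) \<and>
         P {1..n} = P {1} * (\<Prod>j = 2..n. P {j})"
proof -
  have tail: "P {Suc 1..n} = (\<Prod>j = 2..n. P {j})"
    using prevision_tail[OF assms(4), of "Suc 1"] assms(1) by (simp only: Suc_1)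
  have "conjunction H (none_before H) P {1..n} \<omega> = P {Suc 1..n} * indicator (H 1) \<omega>" for \<omega>
    by (rule conjunction_tail) (use assms(1) in \<open>auto simp: none_before_def\<close>)
  moreover have "P {1..n} = P {1} * P {Suc 1..n}"
    using prevision_tail_step[OF assms(4), of 1] assms(1) by simp
  ultimately show ?thesis using tail by auto
qed

end
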